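(* There is a decidable stably infinite theory $\mathcal{T}'$ such that, for every decidable theory $\mathcal{T}$, if $\mathcal{T}\sqcup\mathcal{T}'$ is decidable then $\mathcal{T}$ is stably infinite.
   Context: All logic is one-sorted first-order logic with equality, and all signatures are countable. A $\Sigma$-theory is a set of $\Sigma$-sentences; a $\mathcal{T}$-interpretation is a $\Sigma$-structure (nonempty domain) with a variable assignment satisfying all axioms of $\mathcal{T}$. $\mathcal{T}$ is decidable if there is an algorithm deciding, for a quantifier-free $\Sigma$-formula, whether some $\mathcal{T}$-interpretation satisfies it. For theories $\mathcal{T}_1,\mathcal{T}_2$, the disjoint combination $\mathcal{T}_1\sqcup\mathcal{T}_2$ is the theory over the disjoint union of their signatures (renamed to share only equality) axiomatized by the union of their axioms. A theory $\mathcal{T}$ is stably infinite if every $\mathcal{T}$-satisfiable quantifier-free formula is satisfied by some $\mathcal{T}$-interpretation with infinite domain. *)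

theory Defs
  imports
    "HOL-Library.Nat_Bijection"
    "HOL-Library.Countable_Set"
    "HOL-Library.Infinite_Typeclass"
begin

section \<open>Syntax\<close>

datatype 's trm =
    Var nat
  | Fun 's "'s trm list"

datatype 's form =
    Eq "'s trm" "'s trm"
  | Rel 's "'s trm list"
  | Neg "'s form"
  | Conj "'s form" "'s form"
  | All nat "'s form"

text \<open>
  Signatures are countable, so symbols are natural numbers. A signature maps each of its function
  and predicate symbols to its arity, and all other numbers to \<^const>\<open>None\<close>; constants and
  propositional variables are symbols of arity 0.
\<close>

record signature =
  fun_ar :: "nat \<Rightarrow> nat option"
  rel_ar :: "nat \<Rightarrow> nat option"

fun wf_trm :: "signature \<Rightarrow> nat trm \<Rightarrow> bool" where
  "wf_trm \<Sigma> (Var x) \<longleftrightarrow> True"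
| "wf_trm \<Sigma> (Fun f ts) \<longleftrightarrow> fun_ar \<Sigma> f = Some (length ts) \<and> (\<forall>t \<in> set ts. wf_trm \<Sigma> t)"

fun wf_form :: "signature \<Rightarrow> nat form \<Rightarrow> bool" where
  "wf_form \<Sigma> (Eq s t) \<longleftrightarrow> wf_trm \<Sigma> s \<and> wf_trm \<Sigma> t"
| "wf_form \<Sigma> (Rel p ts) \<longleftrightarrow> rel_ar \<Sigma> p = Some (length ts) \<and> (\<forall>t \<in> set ts. wf_trm \<Sigma> t)"
| "wf_form \<Sigma> (Neg \<phi>) \<longleftrightarrow> wf_form \<Sigma> \<phi>"
| "wf_form \<Sigma> (Conj \<phi> \<psi>) \<longleftrightarrow> wf_form \<Sigma> \<phi> \<and> wf_form \<Sigma> \<psi>"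
| "wf_form \<Sigma> (All x \<phi>) \<longleftrightarrow> wf_form \<Sigma> \<phi>"

fun fv_trm :: "'s trm \<Rightarrow> nat set" where
  "fv_trm (Var x) = {x}"
| "fv_trm (Fun f ts) = (\<Union>t \<in> set ts. fv_trm t)"

fun fv :: "'s form \<Rightarrow> nat set" where
  "fv (Eq s t) = fv_trm s \<union> fv_trm t"
| "fv (Rel p ts) = (\<Union>t \<in> set ts. fv_trm t)"
| "fv (Neg \<phi>) = fv \<phi>"
| "fv (Conj \<phi> \<psi>) = fv \<phi> \<union> fv \<psi>"
| "fv (All x \<phi>) = fv \<phi> - {x}"

fun qfree :: "'s form \<Rightarrow> bool" where
  "qfree (Eq s t) \<longleftrightarrow> True"
| "qfree (Rel p ts) \<longleftrightarrow> True"
| "qfree (Neg \<phi>) \<longleftrightarrow> qfree \<phi>"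
| "qfree (Conj \<phi> \<psi>) \<longleftrightarrow> qfree \<phi> \<and> qfree \<psi>"
| "qfree (All x \<phi>) \<longleftrightarrow> False"

record fo_theory =
  sig :: signature
  axs :: "nat form set"

definition is_theory :: "fo_theory \<Rightarrow> bool" where
  "is_theory T \<longleftrightarrow> (\<forall>\<alpha> \<in> axs T. wf_form (sig T) \<alpha> \<and> fv \<alpha> = {})"

text \<open>
  The disjoint union of two signatures renames the symbol \<open>n\<close> of the first signature to \<open>2 * n\<close>
  and that of the second one to \<open>2 * n + 1\<close>.
\<close>

definition sig_union :: "signature \<Rightarrow> signature \<Rightarrow> signature" where
  "sig_union \<Sigma>1 \<Sigma>2 =
     \<lparr> fun_ar = (\<lambda>s. case sum_decode s of Inl n \<Rightarrow> fun_ar \<Sigma>1 n | Inr n \<Rightarrow> fun_ar \<Sigma>2 n),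
       rel_ar = (\<lambda>s. case sum_decode s of Inl n \<Rightarrow> rel_ar \<Sigma>1 n | Inr n \<Rightarrow> rel_ar \<Sigma>2 n) \<rparr>"

definition disjoint_combination :: "fo_theory \<Rightarrow> fo_theory \<Rightarrow> fo_theory" where
  "disjoint_combination T1 T2 =
     \<lparr> sig = sig_union (sig T1) (sig T2),
       axs = map_form (\<lambda>n. sum_encode (Inl n)) ` axs T1 \<union>
             map_form (\<lambda>n. sum_encode (Inr n)) ` axs T2 \<rparr>"


section \<open>Semantics\<close>

text \<open>
  Domains are nonempty subsets of a universe type \<open>'u\<close>. The notions below that quantify over
  structures take this type as a parameter; the lemmas at the end of this section show that they
  do not depend on it as long as it is infinite.
\<close>

record 'u struc =
  Dom :: "'u set"
  Fi :: "nat \<Rightarrow> 'u list \<Rightarrow> 'u"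
  Ri :: "nat \<Rightarrow> 'u list \<Rightarrow> bool"

definition is_structure :: "signature \<Rightarrow> 'u struc \<Rightarrow> bool" where
  "is_structure \<Sigma> M \<longleftrightarrow>
     Dom M \<noteq> {} \<and>
     (\<forall>f xs. fun_ar \<Sigma> f = Some (length xs) \<and> set xs \<subseteq> Dom M \<longrightarrow> Fi M f xs \<in> Dom M)"

primrec tval :: "'u struc \<Rightarrow> (nat \<Rightarrow> 'u) \<Rightarrow> nat trm \<Rightarrow> 'u" where
  "tval M v (Var x) = v x"
| "tval M v (Fun f ts) = Fi M f (map (tval M v) ts)"

primrec sat :: "'u struc \<Rightarrow> (nat \<Rightarrow> 'u) \<Rightarrow> nat form \<Rightarrow> bool" where
  "sat M v (Eq s t) \<longleftrightarrow> tval M v s = tval M v t"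
| "sat M v (Rel p ts) \<longleftrightarrow> Ri M p (map (tval M v) ts)"
| "sat M v (Neg \<phi>) \<longleftrightarrow> \<not> sat M v \<phi>"
| "sat M v (Conj \<phi> \<psi>) \<longleftrightarrow> sat M v \<phi> \<and> sat M v \<psi>"
| "sat M v (All x \<phi>) \<longleftrightarrow> (\<forall>a \<in> Dom M. sat M (v(x := a)) \<phi>)"

definition is_interp :: "fo_theory \<Rightarrow> 'u struc \<Rightarrow> (nat \<Rightarrow> 'u) \<Rightarrow> bool" where
  "is_interp T M v \<longleftrightarrow>
     is_structure (sig T) M \<and> range v \<subseteq> Dom M \<and> (\<forall>\<alpha> \<in> axs T. sat M v \<alpha>)"

definition satisfiable :: "'u itself \<Rightarrow> fo_theory \<Rightarrow> nat form \<Rightarrow> bool" where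
  "satisfiable U T \<phi> \<longleftrightarrow> (\<exists>M (v :: nat \<Rightarrow> 'u). is_interp T M v \<and> sat M v \<phi>)"

definition inf_satisfiable :: "'u itself \<Rightarrow> fo_theory \<Rightarrow> nat form \<Rightarrow> bool" where
  "inf_satisfiable U T \<phi> \<longleftrightarrow>
     (\<exists>M (v :: nat \<Rightarrow> 'u). is_interp T M v \<and> infinite (Dom M) \<and> sat M v \<phi>)"

definition stably_infinite :: "'u itself \<Rightarrow> fo_theory \<Rightarrow> bool" where
  "stably_infinite U T \<longleftrightarrow>
     (\<forall>\<phi>. wf_form (sig T) \<phi> \<and> qfree \<phi> \<and> satisfiable U T \<phi> \<longrightarrow> inf_satisfiable U T \<phi>)"


subsection \<open>Independence of the universe type\<close>

lemma finite_fv_trm: "finite (fv_trm t)"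
  by (induction t) auto

lemma finite_fv: "finite (fv \<phi>)"
  by (induction \<phi>) (auto simp: finite_fv_trm)

lemma tval_cong: "(\<And>x. x \<in> fv_trm t \<Longrightarrow> v x = w x) \<Longrightarrow> tval M v t = tval M w t"
proof (induction t)
  case (Fun f ts)
  have "map (tval M v) ts = map (tval M w) ts"
    by (rule map_cong[OF refl], rule Fun.IH) (use Fun.prems in auto)
  then show ?case by (simp only: tval.simps)
qed simp

lemma sat_cong: "(\<And>x. x \<in> fv \<phi> \<Longrightarrow> v x = w x) \<Longrightarrow> sat M v \<phi> = sat M w \<phi>"
proof (induction \<phi> arbitrary: v w)
  case (Eq s t)
  have "tval M v s = tval M w s" "tval M v t = tval M w t"
    by (rule tval_cong, use Eq in auto)+
  then show ?case by simp
next
  case (Rel p ts)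
  have "map (tval M v) ts = map (tval M w) ts"
    by (rule map_cong[OF refl], rule tval_cong) (use Rel.prems in auto)
  then show ?case by (simp only: sat.simps)
next
  case (Neg \<phi>)
  have "sat M v \<phi> = sat M w \<phi>" by (rule Neg.IH) (use Neg.prems in auto)
  then show ?case by simp
next
  case (Conj \<phi> \<psi>)
  have "sat M v \<phi> = sat M w \<phi>" by (rule Conj.IH(1)) (use Conj.prems in auto)
  moreover have "sat M v \<psi> = sat M w \<psi>" by (rule Conj.IH(2)) (use Conj.prems in auto)
  ultimately show ?case by simp
next
  case (All x \<phi>)
  have "sat M (v(x := a)) \<phi> = sat M (w(x := a)) \<phi>" for a
    by (rule All.IH) (use All.prems in auto)
  then show ?case by simp
qed

lemma tval_in_Dom:
  assumes "is_structure \<Sigma> M" "range v \<subseteq> Dom M"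
  shows "wf_trm \<Sigma> t \<Longrightarrow> tval M v t \<in> Dom M"
proof (induction t)
  case (Fun f ts)
  then have "set (map (tval M v) ts) \<subseteq> Dom M" by auto
  then show ?case using assms(1) Fun.prems unfolding is_structure_def by simp
qed (use assms in auto)

datatype skolem =
    Elem nat
  | App nat "skolem list"
  | Wit "nat form" nat "skolem list"

instance trm :: (countable) countable
  by countable_datatype

instance form :: (countable) countable
  by countable_datatype

instance skolem :: countable
  by countable_datatype

definition list_assign :: "'u \<Rightarrow> 'u list \<Rightarrow> nat \<Rightarrow> 'u" where
  "list_assign d ws i = (if i < length ws then ws ! i else d)"

primrec skolem_val :: "signature \<Rightarrow> 'u struc \<Rightarrow> (nat \<Rightarrow> 'u) \<Rightarrow> skolem \<Rightarrow> 'u" where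
  "skolem_val \<Sigma> M e (Elem n) = e n"
| "skolem_val \<Sigma> M e (App f ts) =
     (if fun_ar \<Sigma> f = Some (length ts) then Fi M f (map (skolem_val \<Sigma> M e) ts) else e 0)"
| "skolem_val \<Sigma> M e (Wit \<phi> x ts) =
     (let w = list_assign (e 0) (map (skolem_val \<Sigma> M e) ts) in
      if \<exists>a \<in> Dom M. \<not> sat M (w(x := a)) \<phi>
      then SOME a. a \<in> Dom M \<and> \<not> sat M (w(x := a)) \<phi> else e 0)"

lemma skolem_val_in_Dom:
  assumes "is_structure \<Sigma> M" "range e \<subseteq> Dom M"
  shows "skolem_val \<Sigma> M e s \<in> Dom M"
proof (induction s)
  case (App f ts)
  then have "set (map (skolem_val \<Sigma> M e) ts) \<subseteq> Dom M" by auto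
  moreover have "e 0 \<in> Dom M" using assms(2) by blast
  ultimately show ?case using assms(1) unfolding is_structure_def by simp
next
  case (Wit \<phi> x ts)
  define w where "w = list_assign (e 0) (map (skolem_val \<Sigma> M e) ts)"
  show ?case
  proof (cases "\<exists>a. a \<in> Dom M \<and> \<not> sat M (w(x := a)) \<phi>")
    case True
    from someI_ex[OF True] True show ?thesis by (auto simp: Let_def w_def)
  next
    case False
    then show ?thesis using assms(2) by (auto simp: Let_def w_def)
  qed
qed (use assms in auto)

lemma tval_Dom_update: "tval (M\<lparr>Dom := D\<rparr>) w t = tval M w t"
proof (induction t)
  case (Fun f ts)
  then show ?case by (simp cong: map_cong)
qed simp

lemma downward_Lowenheim_Skolem:
  assumes M: "is_structure \<Sigma> M" and e: "range (e :: nat \<Rightarrow> 'u) \<subseteq> Dom M"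
  obtains D where "countable D" "range e \<subseteq> D" "D \<subseteq> Dom M" "is_structure \<Sigma> (M\<lparr>Dom := D\<rparr>)"
    "\<And>w \<phi>. range w \<subseteq> D \<Longrightarrow> sat (M\<lparr>Dom := D\<rparr>) w \<phi> = sat M w \<phi>"
proof
  let ?s = "skolem_val \<Sigma> M e"
  let ?D = "range ?s"
  let ?N = "M\<lparr>Dom := ?D\<rparr>"
  show "countable ?D" by simp
  show "range e \<subseteq> ?D"
  proof
    fix y assume "y \<in> range e"
    then obtain n where "y = ?s (Elem n)" by auto
    then show "y \<in> ?D" by blast
  qed
  show sub: "?D \<subseteq> Dom M" using skolem_val_in_Dom[OF M e] by blast
  have lists: "\<exists>ts. xs = map ?s ts" if "set xs \<subseteq> ?D" for xs
    unfolding ex_map_conv using that by auto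
  show "is_structure \<Sigma> ?N"
    unfolding is_structure_def
  proof (intro conjI allI impI)
    show "Dom ?N \<noteq> {}" by simp
    fix f xs assume *: "fun_ar \<Sigma> f = Some (length xs) \<and> set xs \<subseteq> Dom ?N"
    then obtain ts where ts: "xs = map ?s ts" using lists by auto
    with * have "Fi M f xs = ?s (App f ts)" by simp
    then have "Fi M f xs \<in> ?D" by (simp only: rangeI)
    then show "Fi ?N f xs \<in> Dom ?N" by simp
  qed
  show "sat ?N w \<phi> = sat M w \<phi>" if "range w \<subseteq> ?D" for w \<phi>
    using that
  proof (induction \<phi> arbitrary: w)
    case (All x \<phi>)
    have upd: "sat ?N (w(x := a)) \<phi> = sat M (w(x := a)) \<phi>" if "a \<in> ?D" for a
      by (rule All.IH) (use All.prems that in auto)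
    have "\<forall>a \<in> Dom M. sat M (w(x := a)) \<phi>" if all: "\<forall>a \<in> ?D. sat M (w(x := a)) \<phi>"
    proof (rule ccontr)
      assume "\<not> ?thesis"
      then obtain a where a: "a \<in> Dom M" "\<not> sat M (w(x := a)) \<phi>" by blast
      obtain n where n: "\<And>i. i \<in> fv \<phi> \<Longrightarrow> i < n"
        using finite_fv[of \<phi>] by (auto simp: finite_nat_set_iff_bounded)
      have "set (map w [0..<n]) \<subseteq> ?D" using All.prems by auto
      then obtain ts where ts: "map w [0..<n] = map ?s ts" using lists by blast
      define w' where "w' = list_assign (e 0) (map ?s ts)"
      have w': "w' i = w i" if "i \<in> fv \<phi>" for i
        using n[OF that] unfolding w'_def ts[symmetric] list_assign_def by simp
      have eq: "sat M (w'(x := b)) \<phi> = sat M (w(x := b)) \<phi>" for b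
        by (rule sat_cong) (use w' in auto)
      have ex: "\<exists>b. b \<in> Dom M \<and> \<not> sat M (w'(x := b)) \<phi>" using a eq by blast
      have "?s (Wit \<phi> x ts) = (SOME b. b \<in> Dom M \<and> \<not> sat M (w'(x := b)) \<phi>)"
        using ex by (auto simp: Let_def w'_def)
      with someI_ex[OF ex] have "\<not> sat M (w'(x := ?s (Wit \<phi> x ts))) \<phi>" by simp
      with all eq show False by blast
    qed
    moreover have "sat ?N w (All x \<phi>) \<longleftrightarrow> (\<forall>a \<in> ?D. sat M (w(x := a)) \<phi>)"
      using upd by simp
    ultimately show ?case using sub unfolding sat.simps by blast
  qed (simp_all add: tval_Dom_update cong: map_cong)
qed

definition transport :: "('u \<Rightarrow> 'v) \<Rightarrow> 'u struc \<Rightarrow> 'v struc" where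
  "transport g M =
     \<lparr> Dom = g ` Dom M,
       Fi = (\<lambda>f ys. g (Fi M f (map (inv_into (Dom M) g) ys))),
       Ri = (\<lambda>p ys. Ri M p (map (inv_into (Dom M) g) ys)) \<rparr>"

lemma transport_structure:
  assumes "is_structure \<Sigma> M"
  shows "is_structure \<Sigma> (transport g M)"
proof -
  have "Fi M f (map (inv_into (Dom M) g) ys) \<in> Dom M"
    if "fun_ar \<Sigma> f = Some (length ys)" "set ys \<subseteq> g ` Dom M" for f ys
  proof -
    have "set (map (inv_into (Dom M) g) ys) \<subseteq> Dom M"
      using that(2) by (auto intro: inv_into_into)
    then show ?thesis using assms that(1) unfolding is_structure_def by simp
  qed
  then show ?thesis using assms unfolding is_structure_def transport_def by auto
qed

lemma transport_tval:
  assumes g: "inj_on g (Dom M)" and M: "is_structure \<Sigma> M" and w: "range w \<subseteq> Dom M"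
  shows "wf_trm \<Sigma> t \<Longrightarrow> tval (transport g M) (\<lambda>i. g (w i)) t = g (tval M w t)"
proof (induction t)
  case (Fun f ts)
  have "inv_into (Dom M) g (tval (transport g M) (\<lambda>i. g (w i)) t) = tval M w t" if "t \<in> set ts" for t
    using Fun.IH[OF that] Fun.prems that tval_in_Dom[OF M w, of t] inv_into_f_f[OF g] by simp
  then have "map (inv_into (Dom M) g) (map (tval (transport g M) (\<lambda>i. g (w i))) ts) = map (tval M w) ts"
    by simp
  then show ?case by (simp add: transport_def del: map_map)
qed simp

lemma transport_sat:
  assumes g: "inj_on g (Dom M)" and M: "is_structure \<Sigma> M"
  shows "wf_form \<Sigma> \<phi> \<Longrightarrow> range w \<subseteq> Dom M \<Longrightarrow> sat (transport g M) (\<lambda>i. g (w i)) \<phi> = sat M w \<phi>"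
proof (induction \<phi> arbitrary: w)
  case (Eq s t)
  then show ?case
    using transport_tval[OF g M] tval_in_Dom[OF M Eq.prems(2)] by (auto simp: inj_on_eq_iff[OF g])
next
  case (Rel p ts)
  have "inv_into (Dom M) g (tval (transport g M) (\<lambda>i. g (w i)) t) = tval M w t" if "t \<in> set ts" for t
    using transport_tval[OF g M Rel.prems(2), of t] Rel.prems that
      tval_in_Dom[OF M Rel.prems(2), of t] inv_into_f_f[OF g] by simp
  then have "map (inv_into (Dom M) g) (map (tval (transport g M) (\<lambda>i. g (w i))) ts) = map (tval M w) ts"
    by simp
  then show ?case by (simp add: transport_def del: map_map)
next
  case (All x \<phi>)
  have "sat (transport g M) ((\<lambda>i. g (w i))(x := g a)) \<phi> = sat M (w(x := a)) \<phi>" if "a \<in> Dom M" for a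
  proof -
    have "(\<lambda>i. g (w i))(x := g a) = (\<lambda>i. g ((w(x := a)) i))" by auto
    moreover have "sat (transport g M) (\<lambda>i. g ((w(x := a)) i)) \<phi> = sat M (w(x := a)) \<phi>"
      by (rule All.IH) (use All.prems that in auto)
    ultimately show ?thesis by simp
  qed
  moreover have "Dom (transport g M) = g ` Dom M" by (simp add: transport_def)
  ultimately show ?case by simp
qed auto

lemma interp_change_universe:
  assumes T: "is_theory T" and \<phi>: "wf_form (sig T) \<phi>"
    and M: "is_interp T M (v :: nat \<Rightarrow> 'u)" "sat M v \<phi>"
  shows "\<exists>N (w :: nat \<Rightarrow> 'v :: infinite).
           is_interp T N w \<and> sat N w \<phi> \<and> (infinite (Dom M) \<longrightarrow> infinite (Dom N))"
proof -
  have str: "is_structure (sig T) M" and v: "range v \<subseteq> Dom M"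
    using M(1) by (auto simp: is_interp_def)
  obtain C where C: "countable C" "C \<subseteq> Dom M" "range v \<subseteq> C" "infinite (Dom M) \<longrightarrow> infinite C"
  proof (cases "finite (Dom M)")
    case True
    then show ?thesis using that[of "Dom M"] v by (simp add: countable_finite)
  next
    case False
    then obtain c :: "nat \<Rightarrow> 'u" where c: "inj c" "range c \<subseteq> Dom M"
      using infinite_countable_subset by blast
    show ?thesis
      using that[of "range v \<union> range c"] v c range_inj_infinite[OF c(1)] by auto
  qed
  then have "C \<noteq> {}" by auto
  then have e: "range (from_nat_into C) = C"
    using C(1) by (rule range_from_nat_into)
  obtain D where D: "countable D" "C \<subseteq> D" "is_structure (sig T) (M\<lparr>Dom := D\<rparr>)"
      "\<And>w \<psi>. range w \<subseteq> D \<Longrightarrow> sat (M\<lparr>Dom := D\<rparr>) w \<psi> = sat M w \<psi>"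
    using downward_Lowenheim_Skolem[OF str, of "from_nat_into C"] C(2) e by metis
  obtain h :: "nat \<Rightarrow> 'v" where h: "inj h"
    using infinite_countable_subset[OF infinite_UNIV] by blast
  define g where "g = h \<circ> to_nat_on D"
  let ?M = "M\<lparr>Dom := D\<rparr>"
  have g: "inj_on g (Dom ?M)"
    unfolding g_def using h D(1)
    by (auto intro!: comp_inj_on inj_on_to_nat_on intro: inj_on_subset)
  have vD: "range v \<subseteq> Dom ?M" using C(3) D(2) by auto
  have sat: "sat (transport g ?M) (\<lambda>i. g (v i)) \<psi> = sat M v \<psi>" if "wf_form (sig T) \<psi>" for \<psi>
    using transport_sat[OF g D(3) that vD] D(4)[of v \<psi>] vD by simp
  have dom: "Dom (transport g ?M) = g ` D" by (simp add: transport_def)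
  have "is_interp T (transport g ?M) (\<lambda>i. g (v i))"
    unfolding is_interp_def
  proof (intro conjI ballI)
    show "is_structure (sig T) (transport g ?M)" by (rule transport_structure[OF D(3)])
    show "range (\<lambda>i. g (v i)) \<subseteq> Dom (transport g ?M)" using vD by (auto simp: dom)
    show "sat (transport g ?M) (\<lambda>i. g (v i)) \<alpha>" if "\<alpha> \<in> axs T" for \<alpha>
      using that sat T M(1) by (auto simp: is_theory_def is_interp_def)
  qed
  moreover have "sat (transport g ?M) (\<lambda>i. g (v i)) \<phi>" using sat[OF \<phi>] M(2) by simp
  moreover have "infinite (Dom (transport g ?M))" if "infinite (Dom M)"
    using that C(4) D(2) g by (auto simp: dom finite_image_iff dest: finite_subset)
  ultimately show ?thesis by blast
qed

lemma satisfiable_universe_imp: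
  assumes T: "is_theory T" "wf_form (sig T) \<phi>" and sat: "satisfiable TYPE('u) T \<phi>"
  shows "satisfiable TYPE('v :: infinite) T \<phi>"
proof -
  from sat obtain M and v :: "nat \<Rightarrow> 'u" where M: "is_interp T M v" "sat M v \<phi>"
    unfolding satisfiable_def by blast
  from interp_change_universe[OF T M(1,2), where 'v = 'v]
  show ?thesis unfolding satisfiable_def by blast
qed

lemma satisfiable_universe:
  assumes "is_theory T" "wf_form (sig T) \<phi>"
  shows "satisfiable TYPE('u :: infinite) T \<phi> = satisfiable TYPE('v :: infinite) T \<phi>"
  by (rule iffI; rule satisfiable_universe_imp[OF assms])

lemma inf_satisfiable_universe_imp:
  assumes T: "is_theory T" "wf_form (sig T) \<phi>" and sat: "inf_satisfiable TYPE('u) T \<phi>"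
  shows "inf_satisfiable TYPE('v :: infinite) T \<phi>"
proof -
  from sat obtain M and v :: "nat \<Rightarrow> 'u" where M: "is_interp T M v" "sat M v \<phi>" "infinite (Dom M)"
    unfolding inf_satisfiable_def by blast
  from interp_change_universe[OF T M(1,2), where 'v = 'v] M(3)
  show ?thesis unfolding inf_satisfiable_def by blast
qed

lemma inf_satisfiable_universe:
  assumes "is_theory T" "wf_form (sig T) \<phi>"
  shows "inf_satisfiable TYPE('u :: infinite) T \<phi> = inf_satisfiable TYPE('v :: infinite) T \<phi>"
  by (rule iffI; rule inf_satisfiable_universe_imp[OF assms])

lemma stably_infinite_universe:
  assumes "is_theory T"
  shows "stably_infinite TYPE('u :: infinite) T = stably_infinite TYPE('v :: infinite) T"
proof -
  have "(wf_form (sig T) \<phi> \<and> qfree \<phi> \<and> satisfiable TYPE('u) T \<phi> \<longrightarrow> inf_satisfiable TYPE('u) T \<phi>) =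
      (wf_form (sig T) \<phi> \<and> qfree \<phi> \<and> satisfiable TYPE('v) T \<phi> \<longrightarrow> inf_satisfiable TYPE('v) T \<phi>)" for \<phi>
    using satisfiable_universe[OF assms, of \<phi>, where 'u = 'u and 'v = 'v]
      inf_satisfiable_universe[OF assms, of \<phi>, where 'u = 'u and 'v = 'v] by argo
  then show ?thesis unfolding stably_infinite_def by simp
qed


section \<open>Decidability\<close>

text \<open>
  Algorithms are Kleene's partial recursive functions. The relation \<open>reval r xs y\<close> says that
  \<open>r\<close> halts on the arguments \<open>xs\<close> with value \<open>y\<close>.
\<close>

datatype recf =
    Zero
  | Succ
  | Proj nat
  | Comp recf "recf list"
  | Prec recf recf
  | Mu recf

inductive reval :: "recf \<Rightarrow> nat list \<Rightarrow> nat \<Rightarrow> bool" where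
  zero: "reval Zero xs 0"
| succ: "reval Succ [x] (Suc x)"
| proj: "i < length xs \<Longrightarrow> reval (Proj i) xs (xs ! i)"
| comp: "list_all2 (\<lambda>g y. reval g xs y) gs ys \<Longrightarrow> reval f ys z \<Longrightarrow> reval (Comp f gs) xs z"
| prec_0: "reval f xs y \<Longrightarrow> reval (Prec f g) (0 # xs) y"
| prec_Suc: "reval (Prec f g) (n # xs) y \<Longrightarrow> reval g (n # y # xs) z \<Longrightarrow>
    reval (Prec f g) (Suc n # xs) z"
| mu: "reval f (n # xs) 0 \<Longrightarrow> (\<And>m. m < n \<Longrightarrow> \<exists>y > 0. reval f (m # xs) y) \<Longrightarrow>
    reval (Mu f) xs n"
monos list.rel_mono_strong

inductive_cases reval_ZeroE: "reval Zero xs y"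
inductive_cases reval_SuccE: "reval Succ xs y"
inductive_cases reval_ProjE: "reval (Proj i) xs y"
inductive_cases reval_CompE: "reval (Comp f gs) xs y"
inductive_cases reval_Prec0E: "reval (Prec f g) (0 # xs) y"
inductive_cases reval_PrecSucE: "reval (Prec f g) (Suc n # xs) y"
inductive_cases reval_MuE: "reval (Mu f) xs y"

lemma reval_deterministic: "reval r xs y \<Longrightarrow> reval r xs z \<Longrightarrow> y = z"
proof (induction arbitrary: z rule: reval.induct)
  case (zero xs)
  then show ?case by (rule reval_ZeroE) simp
next
  case (succ x)
  then show ?case by (rule reval_SuccE) simp
next
  case (proj i xs)
  from proj.prems show ?case by (rule reval_ProjE) simp
next
  case (comp xs gs ys f z')
  from comp.prems obtain ys' where ys': "list_all2 (\<lambda>g y. reval g xs y) gs ys'" "reval f ys' z"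
    by (rule reval_CompE)
  have "ys = ys'"
  proof (rule nth_equalityI)
    show "length ys = length ys'"
      using list_all2_lengthD[OF comp.IH(1)] list_all2_lengthD[OF ys'(1)] by simp
    fix i assume "i < length ys"
    then have i: "i < length gs" using list_all2_lengthD[OF comp.IH(1)] by simp
    show "ys ! i = ys' ! i"
      using list_all2_nthD[OF comp.IH(1) i] list_all2_nthD[OF ys'(1) i] by blast
  qed
  with ys'(2) show ?case by (intro comp.IH(2)) simp
next
  case (prec_0 f xs y g)
  from prec_0.prems show ?case by (rule reval_Prec0E) (rule prec_0.IH)
next
  case (prec_Suc f g n xs y z')
  from prec_Suc.prems obtain y' where *: "reval (Prec f g) (n # xs) y'" "reval g (n # y' # xs) z"
    by (rule reval_PrecSucE)
  from prec_Suc.IH(1)[OF *(1)] *(2) show ?case by (intro prec_Suc.IH(2)) simp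
next
  case (mu f n xs)
  from mu.prems have z: "reval f (z # xs) 0" "\<forall>m < z. \<exists>y > 0. reval f (m # xs) y"
    by (rule reval_MuE, simp)+
  have "\<not> z < n"
  proof
    assume "z < n"
    with mu.IH(2) obtain y where "y > 0" "\<forall>y'. reval f (z # xs) y' \<longrightarrow> y = y'" by blast
    with z(1) show False by simp
  qed
  moreover have "\<not> n < z"
  proof
    assume "n < z"
    with z(2) obtain y where "y > 0" "reval f (n # xs) y" by blast
    with mu.IH(1)[of y] show False by simp
  qed
  ultimately show ?case by simp
qed

primrec trm_code :: "nat trm \<Rightarrow> nat" where
  "trm_code (Var x) = prod_encode (0, x)"
| "trm_code (Fun f ts) = prod_encode (1, prod_encode (f, list_encode (map trm_code ts)))"

primrec form_code :: "nat form \<Rightarrow> nat" where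
  "form_code (Eq s t) = prod_encode (0, prod_encode (trm_code s, trm_code t))"
| "form_code (Rel p ts) = prod_encode (1, prod_encode (p, list_encode (map trm_code ts)))"
| "form_code (Neg \<phi>) = prod_encode (2, form_code \<phi>)"
| "form_code (Conj \<phi> \<psi>) = prod_encode (3, prod_encode (form_code \<phi>, form_code \<psi>))"
| "form_code (All x \<phi>) = prod_encode (4, prod_encode (x, form_code \<phi>))"

text \<open>
  The input of the algorithm is promised to be a quantifier-free formula over the signature of
  the theory; nothing is required on other inputs, where the algorithm may also diverge.
\<close>

definition decidable :: "'u itself \<Rightarrow> fo_theory \<Rightarrow> bool" where
  "decidable U T \<longleftrightarrow>
     (\<exists>r. \<forall>\<phi>. wf_form (sig T) \<phi> \<and> qfree \<phi> \<longrightarrow>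
        reval r [form_code \<phi>] (if satisfiable U T \<phi> then 1 else 0))"

lemma decidable_universe:
  assumes "is_theory T"
  shows "decidable TYPE('u :: infinite) T = decidable TYPE('v :: infinite) T"
proof -
  have "(wf_form (sig T) \<phi> \<and> qfree \<phi> \<longrightarrow>
        reval r [form_code \<phi>] (if satisfiable TYPE('u) T \<phi> then 1 else 0)) =
      (wf_form (sig T) \<phi> \<and> qfree \<phi> \<longrightarrow>
        reval r [form_code \<phi>] (if satisfiable TYPE('v) T \<phi> then 1 else 0))" for r \<phi>
    using satisfiable_universe[OF assms, of \<phi>, where 'u = 'u and 'v = 'v] by (cases "wf_form (sig T) \<phi>") simp_all
  then show ?thesis unfolding decidable_def by simp
qed

end

theory Submission
  imports Defs
begin

text \<open>
  Let \<open>K\<close> be an undecidable set. The theory \<open>T'\<close> has propositional symbols \<open>P\<^sub>i\<close> and its axioms say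
  that \<open>P\<^sub>i\<close> implies that the domain is infinite, for every \<open>i \<in> K\<close>. All axioms hold in infinite
  structures, so \<open>T'\<close>-satisfiability of quantifier-free formulas is satisfiability in the logic of
  equality and propositional symbols, which is decidable and always witnessed by infinite
  structures. If \<open>T\<close> is not stably infinite, then some quantifier-free formula \<open>\<phi>\<close> has only finite
  \<open>T\<close>-models, and at least one. Then \<open>\<phi> \<and> P\<^sub>i\<close> is satisfiable in the combination of \<open>T\<close> and \<open>T'\<close>
  if and only if \<open>i \<notin> K\<close>, so the combination is undecidable.

  The decision procedure for \<open>T'\<close> does not recurse on formula codes: it searches for an assignment
  and a table of truth values for all codes up to that of the input, and checks the table locally.
\<close>

section \<open>Total recursive functions\<close>

text \<open>The whole argument list is passed, so that variables are positions; recursion and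
  bounded quantifiers put their new variable at the front.\<close>

definition recursive :: "nat \<Rightarrow> (nat list \<Rightarrow> nat) \<Rightarrow> bool" where
  "recursive n f \<longleftrightarrow> (\<exists>r. \<forall>xs. length xs = n \<longrightarrow> reval r xs (f xs))"

abbreviation recursive_pred :: "nat \<Rightarrow> (nat list \<Rightarrow> bool) \<Rightarrow> bool" where
  "recursive_pred n P \<equiv> recursive n (\<lambda>xs. of_bool (P xs))"

lemma recursive_cong:
  assumes "recursive n f" "\<And>xs. length xs = n \<Longrightarrow> f xs = g xs"
  shows "recursive n g"
  using assms unfolding recursive_def by metis

lemma recursive_proj: "i < n \<Longrightarrow> recursive n (\<lambda>xs. xs ! i)"
  unfolding recursive_def by (metis reval.proj)

lemma recursive_comp:
  assumes F: "recursive (length fs) F" and fs: "\<And>f. f \<in> set fs \<Longrightarrow> recursive n f"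
  shows "recursive n (\<lambda>xs. F (map (\<lambda>f. f xs) fs))"
proof -
  obtain r where r: "\<And>ys. length ys = length fs \<Longrightarrow> reval r ys (F ys)"
    using F unfolding recursive_def by blast
  obtain s where s: "\<And>f xs. f \<in> set fs \<Longrightarrow> length xs = n \<Longrightarrow> reval (s f) xs (f xs)"
    using fs unfolding recursive_def by metis
  have "reval (Comp r (map s fs)) xs (F (map (\<lambda>f. f xs) fs))" if "length xs = n" for xs
    by (rule reval.comp[where ys = "map (\<lambda>f. f xs) fs"])
      (auto simp: list_all2_conv_all_nth s that intro: r)
  then show ?thesis unfolding recursive_def by blast
qed

lemma recursive_comp1:
  assumes "recursive 1 (\<lambda>xs. F (xs ! 0))" "recursive n f"
  shows "recursive n (\<lambda>xs. F (f xs))"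
  using recursive_comp[of "[f]" "\<lambda>xs. F (xs ! 0)" n] assms by simp

lemma recursive_comp2:
  assumes "recursive 2 (\<lambda>xs. F (xs ! 0) (xs ! 1))" "recursive n f" "recursive n g"
  shows "recursive n (\<lambda>xs. F (f xs) (g xs))"
  using recursive_comp[of "[f, g]" "\<lambda>xs. F (xs ! 0) (xs ! 1)" n] assms
  by (auto simp: numeral_2_eq_2)

lemma recursive_Suc:
  assumes "recursive n f"
  shows "recursive n (\<lambda>xs. Suc (f xs))"
proof (rule recursive_comp1[OF _ assms])
  have "reval Succ xs (Suc (xs ! 0))" if "length xs = 1" for xs
    using that reval.succ by (auto simp: length_Suc_conv)
  then show "recursive 1 (\<lambda>xs. Suc (xs ! 0))" unfolding recursive_def by blast
qed

lemma recursive_const: "recursive n (\<lambda>_. k)"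
proof (induction k)
  case 0
  then show ?case unfolding recursive_def by (metis reval.zero)
next
  case (Suc k)
  then show ?case by (rule recursive_Suc)
qed

lemma recursive_rec_nat:
  assumes f: "recursive n f" and h: "recursive (Suc (Suc n)) h" and g: "recursive n g"
  shows "recursive n (\<lambda>xs. rec_nat (f xs) (\<lambda>m y. h (m # y # xs)) (g xs))"
proof -
  obtain rf rh where r: "\<And>xs. length xs = n \<Longrightarrow> reval rf xs (f xs)"
      "\<And>xs. length xs = Suc (Suc n) \<Longrightarrow> reval rh xs (h xs)"
    using f h unfolding recursive_def by blast
  have "reval (Prec rf rh) (k # xs) (rec_nat (f xs) (\<lambda>m y. h (m # y # xs)) k)"
    if "length xs = n" for k xs
    by (induction k) (use r that in \<open>auto intro: reval.prec_0 reval.prec_Suc\<close>)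
  then have "\<forall>ys. length ys = Suc n \<longrightarrow>
      reval (Prec rf rh) ys (rec_nat (f (tl ys)) (\<lambda>m y. h (m # y # tl ys)) (hd ys))"
    by (auto simp: length_Suc_conv)
  then have *: "recursive (Suc n) (\<lambda>ys. rec_nat (f (tl ys)) (\<lambda>m y. h (m # y # tl ys)) (hd ys))"
    unfolding recursive_def by blast
  \<comment> \<open>\<open>Prec\<close> recurses on the first argument. Composing with
    \<open>g\<close> and all projections puts \<open>g xs\<close> there and keeps \<open>xs\<close>
    as parameters.\<close>
  let ?fs = "g # map (\<lambda>i xs. xs ! i) [0..<n]"
  have "recursive n (\<lambda>xs. (\<lambda>ys. rec_nat (f (tl ys)) (\<lambda>m y. h (m # y # tl ys)) (hd ys))
      (map (\<lambda>f. f xs) ?fs))"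
    by (rule recursive_comp) (use * g in \<open>auto intro: recursive_proj\<close>)
  then show ?thesis
  proof (rule recursive_cong)
    fix xs :: "nat list" assume "length xs = n"
    then have "map (\<lambda>f. f xs) (map (\<lambda>i xs. xs ! i) [0..<n]) = xs"
      by (auto simp: list_eq_iff_nth_eq)
    then show "rec_nat (f (tl (map (\<lambda>f. f xs) ?fs))) (\<lambda>m y. h (m # y # tl (map (\<lambda>f. f xs) ?fs)))
        (hd (map (\<lambda>f. f xs) ?fs)) = rec_nat (f xs) (\<lambda>m y. h (m # y # xs)) (g xs)"
      by simp
  qed
qed

lemma recursive_add:
  assumes "recursive n f" "recursive n g"
  shows "recursive n (\<lambda>xs. f xs + g xs)"
proof -
  have "rec_nat a (\<lambda>m y. Suc y) k = a + k" for a k :: nat by (induction k) auto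
  then show ?thesis
    using recursive_rec_nat[OF assms(1) recursive_Suc[OF recursive_proj[of 1 "Suc (Suc n)"]] assms(2)]
    by simp
qed

lemma recursive_mult:
  assumes "recursive n f" "recursive n g"
  shows "recursive n (\<lambda>xs. f xs * g xs)"
proof (rule recursive_comp2[OF _ assms])
  have "recursive (Suc (Suc 2)) (\<lambda>xs. xs ! 1 + xs ! 2)"
    by (intro recursive_add recursive_proj) auto
  from recursive_rec_nat[OF recursive_const[of 2 0] this recursive_proj[of 1]]
  have "recursive 2 (\<lambda>xs. rec_nat 0 (\<lambda>m y. y + xs ! 0) (xs ! 1))" by simp
  moreover have "rec_nat 0 (\<lambda>m y. y + a) k = a * k" for a k :: nat by (induction k) auto
  ultimately show "recursive 2 (\<lambda>xs. xs ! 0 * xs ! 1)" by simp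
qed

lemma recursive_power:
  assumes "recursive n f" "recursive n g"
  shows "recursive n (\<lambda>xs. f xs ^ g xs)"
proof (rule recursive_comp2[OF _ assms])
  have "recursive (Suc (Suc 2)) (\<lambda>xs. xs ! 1 * xs ! 2)"
    by (intro recursive_mult recursive_proj) auto
  from recursive_rec_nat[OF recursive_const[of 2 1] this recursive_proj[of 1]]
  have "recursive 2 (\<lambda>xs. rec_nat 1 (\<lambda>m y. y * xs ! 0) (xs ! 1))" by simp
  moreover have "rec_nat 1 (\<lambda>m y. y * a) k = a ^ k" for a k :: nat by (induction k) auto
  ultimately show "recursive 2 (\<lambda>xs. xs ! 0 ^ xs ! 1)" by simp
qed

lemma recursive_diff:
  assumes "recursive n f" "recursive n g"
  shows "recursive n (\<lambda>xs. f xs - g xs)"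
proof (rule recursive_comp2[OF _ assms])
  have "recursive 1 (\<lambda>xs. rec_nat 0 (\<lambda>m y. m) (xs ! 0))"
    using recursive_rec_nat[OF recursive_const[of 1 0] recursive_proj[of 0] recursive_proj[of 0 1]]
    by simp
  moreover have "rec_nat 0 (\<lambda>m y. m) k = k - 1" for k by (cases k) auto
  ultimately have pred: "recursive 1 (\<lambda>xs. xs ! 0 - 1)" by simp
  have "recursive (Suc (Suc 2)) (\<lambda>xs. xs ! 1 - 1)"
    by (rule recursive_comp1[OF pred recursive_proj]) simp
  from recursive_rec_nat[OF recursive_proj[of 0 2] this recursive_proj[of 1]]
  have "recursive 2 (\<lambda>xs. rec_nat (xs ! 0) (\<lambda>m y. y - 1) (xs ! 1))" by simp
  moreover have "rec_nat a (\<lambda>m y. y - 1) k = a - k" for a k :: nat by (induction k) auto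
  ultimately show "recursive 2 (\<lambda>xs. xs ! 0 - xs ! 1)" by simp
qed

section \<open>Predicates and bounded quantifiers\<close>

lemma recursive_Not:
  assumes "recursive_pred n P"
  shows "recursive_pred n (\<lambda>xs. \<not> P xs)"
  by (rule recursive_cong[OF recursive_diff[OF recursive_const[of n 1] assms]]) simp

lemma recursive_conj:
  assumes "recursive_pred n P" "recursive_pred n Q"
  shows "recursive_pred n (\<lambda>xs. P xs \<and> Q xs)"
  by (rule recursive_cong[OF recursive_mult[OF assms]]) simp

lemma recursive_imp:
  assumes "recursive_pred n P" "recursive_pred n Q"
  shows "recursive_pred n (\<lambda>xs. P xs \<longrightarrow> Q xs)"
  by (rule recursive_cong[OF recursive_Not[OF recursive_conj[OF assms(1) recursive_Not[OF assms(2)]]]])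
    auto

lemma recursive_less:
  assumes "recursive n f" "recursive n g"
  shows "recursive_pred n (\<lambda>xs. f xs < g xs)"
proof -
  \<comment> \<open>With truncated subtraction, \<open>d - (d - 1)\<close> is 1 for positive
    \<open>d\<close> and 0 for \<open>d = 0\<close>.\<close>
  have "recursive n (\<lambda>xs. (g xs - f xs) - (g xs - f xs - 1))"
    by (intro recursive_diff assms recursive_const)
  then show ?thesis by (rule recursive_cong) auto
qed

lemma recursive_eq:
  assumes "recursive n f" "recursive n g"
  shows "recursive_pred n (\<lambda>xs. f xs = g xs)"
  by (rule recursive_cong[OF recursive_conj[OF recursive_Not[OF recursive_less[OF assms]]
      recursive_Not[OF recursive_less[OF assms(2,1)]]]]) auto

lemma recursive_iff:
  assumes "recursive_pred n P" "recursive_pred n Q"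
  shows "recursive_pred n (\<lambda>xs. P xs \<longleftrightarrow> Q xs)"
  by (rule recursive_cong[OF recursive_eq[OF assms]]) auto

lemma recursive_sum:
  assumes f: "recursive (Suc n) f" and g: "recursive n g"
  shows "recursive n (\<lambda>xs. \<Sum>m<g xs. f (m # xs))"
proof -
  let ?fs = "(\<lambda>ys. ys ! 0) # map (\<lambda>i ys. ys ! Suc (Suc i)) [0..<n]"
  have "recursive (Suc (Suc n)) (\<lambda>ys. f (map (\<lambda>f. f ys) ?fs))"
    by (rule recursive_comp) (use f in \<open>auto intro!: recursive_proj\<close>)
  then have "recursive (Suc (Suc n)) (\<lambda>ys. ys ! 1 + f (map (\<lambda>f. f ys) ?fs))"
    by (intro recursive_add recursive_proj) auto
  from recursive_rec_nat[OF recursive_const[of n 0] this g]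
  show ?thesis
  proof (rule recursive_cong)
    fix xs :: "nat list" assume "length xs = n"
    then have *: "map (\<lambda>f. f (m # y # xs)) (map (\<lambda>i ys. ys ! Suc (Suc i)) [0..<n]) = xs" for m y
      by (auto simp: list_eq_iff_nth_eq)
    have "rec_nat 0 (\<lambda>m y. y + f (m # xs)) k = (\<Sum>m<k. f (m # xs))" for k by (induction k) auto
    then show "rec_nat 0 (\<lambda>m y. (m # y # xs) ! 1 + f (map (\<lambda>f. f (m # y # xs)) ?fs)) (g xs) =
        (\<Sum>m<g xs. f (m # xs))"
      unfolding list.map(2) * by simp
  qed
qed

text \<open>The number of witnesses below the bound is a sum of truth values; a witness exists iff
  this sum is positive.\<close>

lemma recursive_bex:
  assumes "recursive_pred (Suc n) P" "recursive n g"
  shows "recursive_pred n (\<lambda>xs. \<exists>m<g xs. P (m # xs))"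
  by (rule recursive_cong[OF recursive_less[OF recursive_const[of n 0] recursive_sum[OF assms]]])
    (auto simp: neq0_conv[symmetric] simp del: neq0_conv of_bool_eq_1_iff)

lemma recursive_ball:
  assumes "recursive_pred (Suc n) P" "recursive n g"
  shows "recursive_pred n (\<lambda>xs. \<forall>m<g xs. P (m # xs))"
  by (rule recursive_cong[OF recursive_Not[OF recursive_bex[OF recursive_Not[OF assms(1)] assms(2)]]])
    auto

text \<open>For \<open>b > 0\<close>, the quotient \<open>a div b\<close> counts the
  \<open>m < a\<close> with \<open>Suc m * b\<close> \<le> \<open>a\<close>; the conjunct
  \<open>0 < b\<close> makes the count 0 for \<open>b = 0\<close>, in accordance with
  \<open>a div 0 = 0\<close>.\<close>

lemma recursive_div:
  assumes "recursive n f" "recursive n g"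
  shows "recursive n (\<lambda>xs. f xs div g xs)"
proof (rule recursive_comp2[OF _ assms])
  have "recursive_pred (Suc 2) (\<lambda>xs. 0 < xs ! 2 \<and> \<not> xs ! 1 < Suc (xs ! 0) * xs ! 2)"
    by (intro recursive_conj recursive_Not recursive_less recursive_mult recursive_Suc
        recursive_const recursive_proj) auto
  from recursive_sum[OF this recursive_proj[of 0 2]]
  show "recursive 2 (\<lambda>xs. xs ! 0 div xs ! 1)"
  proof (rule recursive_cong)
    fix xs :: "nat list"
    have "(\<Sum>m<a. of_bool (0 < b \<and> \<not> a < Suc m * b)) = a div b" for a b :: nat
    proof (cases "b = 0")
      case False
      have "m < a \<and> \<not> a < Suc m * b \<longleftrightarrow> m < a div b" for m
        using False div_le_dividend[of a b]
        by (auto simp: less_eq_div_iff_mult_less_eq[symmetric] not_less Suc_le_eq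
            simp del: mult_Suc intro: less_le_trans)
      then have "{m. m < a \<and> \<not> a < Suc m * b} = {..<a div b}" by auto
      moreover have "(\<Sum>m<a. of_bool (0 < b \<and> \<not> a < Suc m * b)) = card {m. m < a \<and> \<not> a < Suc m * b}"
        using False by (simp add: Int_def conj_commute)
      ultimately show ?thesis by simp
    qed simp
    then show "(\<Sum>m<xs ! 0. of_bool (0 < (m # xs) ! 2 \<and> \<not> (m # xs) ! 1 < Suc ((m # xs) ! 0) * (m # xs) ! 2)) =
        xs ! 0 div xs ! 1"
      by simp
  qed simp
qed

lemma recursive_prod_encode:
  assumes "recursive n f" "recursive n g"
  shows "recursive n (\<lambda>xs. prod_encode (f xs, g xs))"
  unfolding prod_encode_def triangle_def case_prod_conv
  by (intro recursive_add recursive_div recursive_mult recursive_Suc recursive_const assms)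

lemmas recursive_intros =
  recursive_add recursive_mult recursive_power recursive_diff recursive_div recursive_Suc
  recursive_const recursive_prod_encode recursive_Not recursive_conj recursive_imp recursive_iff
  recursive_less recursive_eq

section \<open>Undecidability by diagonalization\<close>

instance recf :: countable
  by countable_datatype

definition diagonal_set :: "nat set" where
  "diagonal_set = {i. reval (from_nat i) [i] 1}"

text \<open>A program computing this predicate, run on its own index, returns 1 iff the index lies
  outside the set, but membership of the index means exactly that it returns 1. The complement
  appears because satisfiability in the combination will express
  \<open>i \<notin> K\<close>.\<close>

lemma diagonal_set_undecidable: "\<not> recursive_pred 1 (\<lambda>xs. xs ! 0 \<notin> diagonal_set)"
proof
  assume "recursive_pred 1 (\<lambda>xs. xs ! 0 \<notin> diagonal_set)"
  then obtain r where r: "\<forall>xs. length xs = 1 \<longrightarrow> reval r xs (of_bool (xs ! 0 \<notin> diagonal_set))"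
    unfolding recursive_def by blast
  let ?i = "to_nat r"
  have *: "reval r [?i] (of_bool (?i \<notin> diagonal_set))" using r[rule_format, of "[?i]"] by simp
  show False
  proof (cases "?i \<in> diagonal_set")
    case True
    then have "reval r [?i] 1" by (simp add: diagonal_set_def)
    with * True show False using reval_deterministic by fastforce
  next
    case False
    with * show False by (simp add: diagonal_set_def)
  qed
qed


section \<open>Bounded search over digit tables\<close>

text \<open>The base-\<open>B\<close> digit of \<open>c\<close> at position \<open>k\<close>. One
  number thus stores a whole table, and looking for a table becomes a bounded search.\<close>

definition digit :: "nat \<Rightarrow> nat \<Rightarrow> nat \<Rightarrow> nat" where
  "digit B c k = c div B ^ k mod B"

text \<open>Horner's scheme: \<open>f 0\<close> is the lowest digit, and \<open>B\<close> times a
  number for the shifted function supplies the others.\<close>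

lemma digit_table_exists:
  assumes "\<And>k. k < n \<Longrightarrow> f k < B"
  shows "\<exists>c<B ^ n. \<forall>k<n. digit B c k = f k"
  using assms
proof (induction n arbitrary: f)
  case (Suc n)
  have "\<And>k. k < n \<Longrightarrow> f (Suc k) < B" using Suc.prems by simp
  from Suc.IH[of "\<lambda>k. f (Suc k)", OF this]
  obtain c where c: "c < B ^ n" "\<And>k. k < n \<Longrightarrow> digit B c k = f (Suc k)" by auto
  have f0: "f 0 < B" using Suc.prems by simp
  have "f 0 + B * c < B + B * c" using f0 by simp
  also have "\<dots> \<le> B * B ^ n" using c(1) by (metis Suc_leI mult_Suc_right mult_le_mono2)
  finally have "f 0 + B * c < B ^ Suc n" by simp
  moreover have "digit B (f 0 + B * c) k = f k" if "k < Suc n" for k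
  proof (cases k)
    case 0
    then show ?thesis using f0 by (simp add: digit_def)
  next
    case (Suc j)
    have "digit B (f 0 + B * c) (Suc j) = digit B c j"
      using f0 by (simp add: digit_def div_mult2_eq)
    then show ?thesis using c(2) that Suc by simp
  qed
  ultimately show ?case by blast
qed simp

lemma recursive_digit:
  assumes "recursive n f" "recursive n g" "recursive n h"
  shows "recursive n (\<lambda>xs. digit (f xs) (g xs) (h xs))"
  unfolding digit_def modulo_nat_def by (intro recursive_intros assms)

text \<open>
  The number \<open>t\<close> is read as a truth table for formula codes below \<open>B\<close>, and \<open>c\<close> as a table of
  values for term codes below \<open>B\<close>. No condition is imposed on the codes of \<^const>\<open>Rel\<close>.
\<close>

definition locally_consistent :: "nat \<Rightarrow> nat \<Rightarrow> nat \<Rightarrow> nat \<Rightarrow> nat \<Rightarrow> bool" where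
  "locally_consistent B c t a b \<longleftrightarrow>
     (prod_encode (0, prod_encode (a, b)) < B \<longrightarrow>
       (0 < digit B t (prod_encode (0, prod_encode (a, b))) \<longleftrightarrow> digit B c a = digit B c b)) \<and>
     (prod_encode (2, a) < B \<longrightarrow>
       (0 < digit B t (prod_encode (2, a)) \<longleftrightarrow> \<not> 0 < digit B t a)) \<and>
     (prod_encode (3, prod_encode (a, b)) < B \<longrightarrow>
       (0 < digit B t (prod_encode (3, prod_encode (a, b))) \<longleftrightarrow>
         0 < digit B t a \<and> 0 < digit B t b))"

text \<open>The base \<open>k + 2\<close> leaves room for position \<open>k\<close> and for the
  digit 1, even for \<open>k = 0\<close>, which is the code of \<open>Eq (Var 0) (Var 0)\<close>.
  Tables with \<open>B\<close> digits are the numbers below \<open>B ^ B\<close>.\<close>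

definition table_satisfiable :: "nat \<Rightarrow> bool" where
  "table_satisfiable k \<longleftrightarrow> (let B = Suc (Suc k) in
     \<exists>c<B ^ B. \<exists>t<B ^ B. 0 < digit B t k \<and> (\<forall>a<B. \<forall>b<B. locally_consistent B c t a b))"

lemma recursive_table_satisfiable: "recursive_pred 1 (\<lambda>xs. table_satisfiable (xs ! 0))"
proof -
  \<comment> \<open>Positions 4 to 0 hold \<open>B\<close>, \<open>c\<close>, \<open>t\<close>,
    \<open>a\<close>, \<open>b\<close>. Each quantifier added below binds position 0 and moves the
    others down by one.\<close>
  have "recursive_pred (Suc 4)
      (\<lambda>xs. locally_consistent (xs ! 4) (xs ! 3) (xs ! 2) (xs ! 1) (xs ! 0))"
    unfolding locally_consistent_def
    by (intro recursive_intros recursive_digit recursive_proj) auto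
  from recursive_ball[OF this recursive_proj[of 3 4]]
  have "recursive_pred (Suc 3)
      (\<lambda>xs. \<forall>b<xs ! 3. locally_consistent (xs ! 3) (xs ! 2) (xs ! 1) (xs ! 0) b)"
    by simp
  from recursive_ball[OF this recursive_proj[of 2 3]]
  have "recursive_pred 3
      (\<lambda>xs. \<forall>a<xs ! 2. \<forall>b<xs ! 2. locally_consistent (xs ! 2) (xs ! 1) (xs ! 0) a b)"
    by simp
  \<comment> \<open>Subtracting 2 recovers the input \<open>k\<close> from the base.\<close>
  then have "recursive_pred (Suc 2) (\<lambda>xs. 0 < digit (xs ! 2) (xs ! 0) (xs ! 2 - 2) \<and>
      (\<forall>a<xs ! 2. \<forall>b<xs ! 2. locally_consistent (xs ! 2) (xs ! 1) (xs ! 0) a b))"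
    by (intro recursive_intros recursive_digit recursive_proj) auto
  from recursive_bex[OF this recursive_power[OF recursive_proj[of 1 2] recursive_proj[of 1 2]]]
  have "recursive_pred (Suc 1) (\<lambda>xs. \<exists>t<xs ! 1 ^ xs ! 1. 0 < digit (xs ! 1) t (xs ! 1 - 2) \<and>
      (\<forall>a<xs ! 1. \<forall>b<xs ! 1. locally_consistent (xs ! 1) (xs ! 0) t a b))"
    by (simp add: numeral_2_eq_2)
  from recursive_bex[OF this recursive_power[OF recursive_proj[of 0 1] recursive_proj[of 0 1]]]
  have "recursive_pred 1 (\<lambda>xs. \<exists>c<xs ! 0 ^ xs ! 0. \<exists>t<xs ! 0 ^ xs ! 0.
      0 < digit (xs ! 0) t (xs ! 0 - 2) \<and>
      (\<forall>a<xs ! 0. \<forall>b<xs ! 0. locally_consistent (xs ! 0) c t a b))"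
    by simp
  from recursive_comp1[OF this recursive_Suc[OF recursive_Suc[OF recursive_proj[of 0 1]]]]
  show ?thesis unfolding table_satisfiable_def Let_def by simp
qed

section \<open>Evaluation of formula codes\<close>

lemma prod_encode_less2: "0 < a \<Longrightarrow> b < prod_encode (a, b)"
  by (cases a) (simp_all add: prod_encode_def)

text \<open>Evaluation is total on numbers, because local consistency also constrains entries that
  are not codes of formulas. Here \<open>e\<close> gives the values of terms and \<open>p\<close>
  the truth of predicate atoms; the remaining tags are left to \<open>p\<close> as well.\<close>

function code_truth :: "(nat \<Rightarrow> nat) \<Rightarrow> (nat \<Rightarrow> bool) \<Rightarrow> nat \<Rightarrow> bool" where
  "code_truth e p k =
     (let h = fst (prod_decode k); m = snd (prod_decode k);
          a = fst (prod_decode m); b = snd (prod_decode m)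
      in if h = 0 then e a = e b
         else if h = 2 then \<not> code_truth e p m
         else if h = 3 then code_truth e p a \<and> code_truth e p b
         else p m)"
  by pat_completeness auto
termination
proof (relation "measure (\<lambda>(e, p, k). k)"; clarsimp)
  have less: "snd (prod_decode k) < k" if "0 < fst (prod_decode k)" for k
    using prod_encode_less2[OF that, of "snd (prod_decode k)"] by simp
  have le: "fst (prod_decode m) \<le> m" "snd (prod_decode m) \<le> m" for m
    using le_prod_encode_1[of "fst (prod_decode m)" "snd (prod_decode m)"]
      le_prod_encode_2[of "snd (prod_decode m)" "fst (prod_decode m)"] by simp_all
  show "snd (prod_decode k) < k" if "fst (prod_decode k) = 2" for k
    using less[of k] that by simp
  show "fst (prod_decode (snd (prod_decode k))) < k" "snd (prod_decode (snd (prod_decode k))) < k"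
    if "fst (prod_decode k) = 3" for k
    using less[of k] le[of "snd (prod_decode k)"] that by simp_all
qed

declare code_truth.simps [simp del]

lemma code_truth_encode [simp]:
  "code_truth e p (prod_encode (0, prod_encode (a, b))) \<longleftrightarrow> e a = e b"
  "code_truth e p (prod_encode (1, m)) \<longleftrightarrow> p m"
  "code_truth e p (prod_encode (2, m)) \<longleftrightarrow> \<not> code_truth e p m"
  "code_truth e p (prod_encode (3, prod_encode (a, b))) \<longleftrightarrow> code_truth e p a \<and> code_truth e p b"
  by (subst code_truth.simps; simp)+

text \<open>The digits of \<open>c\<close> are the values of \<open>e\<close>, those of
  \<open>t\<close> the truth values of all numbers below \<open>?B\<close>. The bound
  \<open>e a \<le> a\<close> ensures that the values are digits in this base.\<close>

lemma table_satisfiableI: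
  assumes e: "\<And>a. e a \<le> a" and k: "code_truth e p k"
  shows "table_satisfiable k"
proof -
  let ?B = "Suc (Suc k)"
  obtain c where c: "c < ?B ^ ?B" "\<And>a. a < ?B \<Longrightarrow> digit ?B c a = e a"
    using digit_table_exists[of ?B e ?B] e by (meson le_less_trans)
  obtain t where t: "t < ?B ^ ?B" "\<And>a. a < ?B \<Longrightarrow> digit ?B t a = of_bool (code_truth e p a)"
    using digit_table_exists[of ?B "\<lambda>a. of_bool (code_truth e p a)" ?B]
    by (metis of_bool_less_eq_one le_less_trans one_less_numeral_iff Suc_less_eq zero_less_Suc One_nat_def)
  have "locally_consistent ?B c t a b" if "a < ?B" "b < ?B" for a b
    unfolding locally_consistent_def using that c(2) t(2) by simp
  moreover have "0 < digit ?B t k" using t(2) k by simp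
  ultimately show ?thesis unfolding table_satisfiable_def Let_def using c(1) t(1) by blast
qed


section \<open>Propositional symbols that force infinite domains\<close>

text \<open>Without function symbols all terms are variables, so a quantifier-free formula is a
  Boolean combination of propositional symbols and equations between variables.\<close>

definition prop_sig :: signature where
  "prop_sig = \<lparr> fun_ar = (\<lambda>_. None), rel_ar = (\<lambda>_. Some 0) \<rparr>"

section \<open>Infinity of the domain by sentences\<close>

primrec Alls :: "nat \<Rightarrow> nat form \<Rightarrow> nat form" where
  "Alls 0 \<phi> = \<phi>"
| "Alls (Suc m) \<phi> = All (Suc m) (Alls m \<phi>)"

primrec fresh :: "nat \<Rightarrow> nat form" where
  "fresh 0 = Eq (Var 0) (Var 0)"
| "fresh (Suc m) = Conj (Neg (Eq (Var 0) (Var (Suc m)))) (fresh m)"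

text \<open>For all x_1, ..., x_m there is an x_0 different from each of them: no
  \<open>m\<close>-tuple exhausts the domain.\<close>

definition more_than :: "nat \<Rightarrow> nat form" where
  "more_than m = Alls m (Neg (All 0 (Neg (fresh m))))"

definition forcing_theory :: "nat set \<Rightarrow> fo_theory" where
  "forcing_theory K =
     \<lparr> sig = prop_sig, axs = {Neg (Conj (Rel i []) (Neg (more_than m))) | i m. i \<in> K} \<rparr>"

lemma sat_Alls:
  "sat M v (Alls m \<phi>) \<longleftrightarrow>
     (\<forall>w. (\<forall>j. j \<notin> {1..m} \<longrightarrow> w j = v j) \<and> (\<forall>j\<in>{1..m}. w j \<in> Dom M) \<longrightarrow> sat M w \<phi>)"
proof (induction m arbitrary: v)
  case 0
  have "w = v" if "\<forall>j. w j = v j" for w using that by auto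
  then show ?case by auto
next
  case (Suc m)
  let ?P = "\<lambda>m v w. (\<forall>j. j \<notin> {1..m} \<longrightarrow> w j = v j) \<and> (\<forall>j\<in>{1..m}. w j \<in> Dom M)"
  \<comment> \<open>Changing \<open>v\<close> on \<open>{1..Suc m}\<close> amounts to choosing the
    value at \<open>Suc m\<close> and then changing the result on \<open>{1..m}\<close>.\<close>
  have *: "?P (Suc m) v w \<longleftrightarrow> (\<exists>a\<in>Dom M. ?P m (v(Suc m := a)) w)" for w
  proof
    assume "?P (Suc m) v w"
    then have "w (Suc m) \<in> Dom M" "?P m (v(Suc m := w (Suc m))) w" by auto
    then show "\<exists>a\<in>Dom M. ?P m (v(Suc m := a)) w" by blast
  next
    assume "\<exists>a\<in>Dom M. ?P m (v(Suc m := a)) w"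
    then obtain a where a: "a \<in> Dom M" "?P m (v(Suc m := a)) w" by blast
    then have "w (Suc m) = a" by auto
    with a show "?P (Suc m) v w"
      by (auto simp: atLeastAtMostSuc_conv split: if_splits)
  qed
  show ?case unfolding Alls.simps sat.simps Suc.IH * by blast
qed

lemma sat_fresh: "sat M v (fresh m) \<longleftrightarrow> (\<forall>j\<in>{1..m}. v 0 \<noteq> v j)"
  by (induction m) (auto simp: atLeastAtMostSuc_conv)

lemma sat_more_than:
  "sat M v (more_than m) \<longleftrightarrow> (\<forall>w. w ` {1..m} \<subseteq> Dom M \<longrightarrow> \<not> Dom M \<subseteq> w ` {1..m})"
proof -
  have "sat M v (more_than m) \<longleftrightarrow>
      (\<forall>w. (\<forall>j. j \<notin> {1..m} \<longrightarrow> w j = v j) \<and> (\<forall>j\<in>{1..m}. w j \<in> Dom M) \<longrightarrow>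
        (\<exists>a\<in>Dom M. \<forall>j\<in>{1..m}. a \<noteq> w j))"
    unfolding more_than_def sat_Alls by (simp add: sat_fresh)
  also have "\<dots> \<longleftrightarrow> (\<forall>w. (\<forall>j\<in>{1..m}. w j \<in> Dom M) \<longrightarrow> (\<exists>a\<in>Dom M. \<forall>j\<in>{1..m}. a \<noteq> w j))"
    (is "?L \<longleftrightarrow> ?R")
  proof
    assume L: ?L
    show ?R
    proof (intro allI impI)
      fix w assume "\<forall>j\<in>{1..m}. w j \<in> Dom M"
      with L[rule_format, of "\<lambda>j. if j \<in> {1..m} then w j else v j"]
      show "\<exists>a\<in>Dom M. \<forall>j\<in>{1..m}. a \<noteq> w j" by auto
    qed
  qed blast
  also have "\<dots> \<longleftrightarrow> (\<forall>w. w ` {1..m} \<subseteq> Dom M \<longrightarrow> \<not> Dom M \<subseteq> w ` {1..m})" by blast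
  finally show ?thesis .
qed

lemma sat_more_than_iff_infinite: "(\<forall>m. sat M v (more_than m)) \<longleftrightarrow> infinite (Dom M)"
proof
  assume all: "\<forall>m. sat M v (more_than m)"
  show "infinite (Dom M)"
  proof
    assume "finite (Dom M)"
    then obtain w where "bij_betw w {1..card (Dom M)} (Dom M)"
      using ex_bij_betw_nat_finite_1 by blast
    then have "w ` {1..card (Dom M)} = Dom M" by (simp add: bij_betw_def)
    with all show False unfolding sat_more_than by blast
  qed
next
  assume "infinite (Dom M)"
  then show "\<forall>m. sat M v (more_than m)"
    unfolding sat_more_than by (meson finite_atLeastAtMost finite_imageI finite_subset)
qed

lemma fv_Alls: "fv (Alls m \<phi>) = fv \<phi> - {1..m}"
  by (induction m) (auto simp: atLeastAtMostSuc_conv)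

lemma fv_fresh: "fv (fresh m) = {0..m}"
  by (induction m) (auto simp: atLeastAtMostSuc_conv)

lemma wf_Alls: "wf_form \<Sigma> (Alls m \<phi>) = wf_form \<Sigma> \<phi>"
  by (induction m) auto

lemma wf_fresh: "wf_form \<Sigma> (fresh m)"
  by (induction m) auto

lemma is_theory_forcing_theory: "is_theory (forcing_theory K)"
  by (auto simp: is_theory_def forcing_theory_def more_than_def wf_Alls wf_fresh fv_Alls fv_fresh
      prop_sig_def)

text \<open>Without function symbols, being a structure only requires a nonempty domain, which
  follows from \<open>range v \<subseteq> Dom M\<close>.\<close>

lemma is_interp_forcing_theory:
  "is_interp (forcing_theory K) M v \<longleftrightarrow>
     range v \<subseteq> Dom M \<and> (\<forall>i\<in>K. Ri M i [] \<longrightarrow> infinite (Dom M))"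
  unfolding sat_more_than_iff_infinite[of M v, symmetric]
  by (fastforce simp: is_interp_def is_structure_def forcing_theory_def prop_sig_def)

section \<open>Correctness of the table search for the forcing theory\<close>

lemma forcing_satisfiable_imp_table:
  assumes \<phi>: "wf_form prop_sig \<phi>" "qfree \<phi>" and sat: "satisfiable TYPE('u) (forcing_theory K) \<phi>"
  shows "table_satisfiable (form_code \<phi>)"
proof -
  obtain M and v :: "nat \<Rightarrow> 'u" where Mv: "sat M v \<phi>"
    using sat unfolding satisfiable_def by blast
  \<comment> \<open>A variable is represented by the least variable with the same value. This
    replaces elements of the domain by numbers not exceeding the code.\<close>
  define e where "e a = (LEAST y. v y = v (snd (prod_decode a)))" for a
  define p where "p m = Ri M (fst (prod_decode m)) []" for m
  have "e a \<le> a" for a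
  proof -
    have "e a \<le> snd (prod_decode a)" unfolding e_def by (rule Least_le) simp
    also have "\<dots> \<le> a"
      using le_prod_encode_2[of "snd (prod_decode a)" "fst (prod_decode a)"] by simp
    finally show ?thesis .
  qed
  moreover have e_eq: "e (prod_encode (0, x)) = e (prod_encode (0, y)) \<longleftrightarrow> v x = v y" for x y
  proof
    have "v (e (prod_encode (0, z))) = v z" for z
      using LeastI[of "\<lambda>y. v y = v z" z] by (simp add: e_def)
    then show "e (prod_encode (0, x)) = e (prod_encode (0, y)) \<Longrightarrow> v x = v y" by metis
  qed (simp add: e_def)
  have "code_truth e p (form_code \<psi>) \<longleftrightarrow> sat M v \<psi>" if "wf_form prop_sig \<psi>" "qfree \<psi>" for \<psi>
    using that
  proof (induction \<psi>)
    case (Eq s t)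
    then obtain x y where "s = Var x" "t = Var y"
      by (cases s; cases t) (auto simp: prop_sig_def)
    then show ?case by (simp add: e_eq)
  next
    case (Rel q ts)
    then show ?case by (simp add: prop_sig_def p_def del: One_nat_def)
  qed (simp_all add: numeral_eq_Suc[symmetric])
  ultimately show ?thesis using table_satisfiableI[of e p] \<phi> Mv by blast
qed

text \<open>The model is read off the tables over the full infinite universe, where every axiom of
  the theory holds. The truth of a propositional symbol is the table entry at the code of its
  atom.\<close>

lemma table_imp_forcing_inf_satisfiable:
  assumes \<phi>: "wf_form prop_sig \<phi>" "qfree \<phi>" and tab: "table_satisfiable (form_code \<phi>)"
  shows "inf_satisfiable TYPE('u :: infinite) (forcing_theory K) \<phi>"
proof -
  define B where "B = Suc (Suc (form_code \<phi>))"
  obtain c t where t: "0 < digit B t (form_code \<phi>)"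
    and ct: "\<And>a b. a < B \<Longrightarrow> b < B \<Longrightarrow> locally_consistent B c t a b"
    using tab unfolding table_satisfiable_def B_def Let_def by blast
  obtain h :: "nat \<Rightarrow> 'u" where h: "inj h"
    using infinite_countable_subset[OF infinite_UNIV] by blast
  define v where "v x = h (digit B c (prod_encode (0, x)))" for x
  \<comment> \<open>\<open>prod_encode (1, prod_encode (q, 0))\<close> is the code of
    \<open>Rel q []\<close>, as \<open>list_encode [] = 0\<close>.\<close>
  define M where "M = \<lparr> Dom = (UNIV :: 'u set), Fi = (\<lambda>_ _. undefined),
    Ri = (\<lambda>q _. 0 < digit B t (prod_encode (1, prod_encode (q, 0)))) \<rparr>"
  have "0 < digit B t (form_code \<psi>) \<longleftrightarrow> sat M v \<psi>"
    if "wf_form prop_sig \<psi>" "qfree \<psi>" "form_code \<psi> < B" for \<psi>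
    using that
  proof (induction \<psi>)
    case (Eq r s)
    then obtain x y where xy: "r = Var x" "s = Var y"
      by (cases r; cases s) (auto simp: prop_sig_def)
    let ?a = "prod_encode (0, x)" and ?b = "prod_encode (0, y)"
    have less: "prod_encode (0, prod_encode (?a, ?b)) < B" using Eq.prems(3) xy by simp
    have "?a < B" "?b < B"
      using less le_prod_encode_1[of ?a ?b] le_prod_encode_2[of ?b ?a]
        le_prod_encode_2[of "prod_encode (?a, ?b)" 0] by linarith+
    with ct[of ?a ?b] less xy h show ?case
      by (simp add: locally_consistent_def v_def inj_eq)
  next
    case (Rel q ts)
    then show ?case by (simp add: prop_sig_def M_def del: One_nat_def)
  next
    case (Neg \<psi>)
    have "form_code \<psi> < B"
      using Neg.prems(3) prod_encode_less2[of 2 "form_code \<psi>"] by simp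
    with Neg ct[of "form_code \<psi>" "form_code \<psi>"] show ?case
      by (simp add: locally_consistent_def)
  next
    case (Conj \<psi> \<chi>)
    let ?a = "form_code \<psi>" and ?b = "form_code \<chi>"
    have less: "prod_encode (3, prod_encode (?a, ?b)) < B" using Conj.prems(3) by simp
    have "?a < B" "?b < B"
      using less le_prod_encode_1[of ?a ?b] le_prod_encode_2[of ?b ?a]
        le_prod_encode_2[of "prod_encode (?a, ?b)" 3] by linarith+
    with Conj ct[of ?a ?b] less show ?case
      by (simp add: locally_consistent_def)
  qed simp
  then have "sat M v \<phi>" using \<phi> t by (simp add: B_def)
  moreover have "infinite (Dom M)" by (simp add: M_def infinite_UNIV)
  moreover have "is_interp (forcing_theory K) M v"
    using calculation(2) by (simp add: is_interp_forcing_theory) (simp add: M_def)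
  ultimately show ?thesis unfolding inf_satisfiable_def by blast
qed

lemma stably_infinite_forcing_theory: "stably_infinite TYPE('u :: infinite) (forcing_theory K)"
  unfolding stably_infinite_def
  using forcing_satisfiable_imp_table table_imp_forcing_inf_satisfiable
  by (fastforce simp: forcing_theory_def)

lemma decidable_forcing_theory: "decidable TYPE('u :: infinite) (forcing_theory K)"
proof -
  obtain r where r: "\<And>xs. length xs = 1 \<Longrightarrow> reval r xs (of_bool (table_satisfiable (xs ! 0)))"
    using recursive_table_satisfiable unfolding recursive_def by blast
  have "satisfiable TYPE('u) (forcing_theory K) \<phi> \<longleftrightarrow> table_satisfiable (form_code \<phi>)"
    if "wf_form prop_sig \<phi>" "qfree \<phi>" for \<phi>
    using forcing_satisfiable_imp_table[OF that, where 'u = 'u and K = K]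
      table_imp_forcing_inf_satisfiable[OF that, where 'u = 'u and K = K]
    unfolding satisfiable_def inf_satisfiable_def by blast
  moreover have "sig (forcing_theory K) = prop_sig" by (simp add: forcing_theory_def)
  ultimately show ?thesis
    unfolding decidable_def using r[of "[form_code _]"] by (intro exI[of _ r]) (simp add: of_bool_def)
qed


section \<open>Disjoint combinations\<close>

text \<open>The pullback of a structure along a renaming of symbols: renaming a formula by
  \<open>g\<close> and evaluating it in \<open>M\<close> is evaluating the original in
  \<open>reduct g M\<close>.\<close>

definition reduct :: "(nat \<Rightarrow> nat) \<Rightarrow> 'u struc \<Rightarrow> 'u struc" where
  "reduct g M = \<lparr> Dom = Dom M, Fi = (\<lambda>f. Fi M (g f)), Ri = (\<lambda>p. Ri M (g p)) \<rparr>"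

lemma tval_map_trm: "tval M v (map_trm g t) = tval (reduct g M) v t"
proof (induction t)
  case (Fun f ts)
  then show ?case by (simp add: reduct_def comp_def cong: map_cong)
qed simp

lemma sat_map_form: "sat M v (map_form g \<phi>) = sat (reduct g M) v \<phi>"
  by (induction \<phi> arbitrary: v) (simp_all add: tval_map_trm comp_def, simp_all add: reduct_def)

lemma is_interp_disjoint_combination:
  "is_interp (disjoint_combination T1 T2) M v \<longleftrightarrow>
     is_interp T1 (reduct (\<lambda>n. sum_encode (Inl n)) M) v \<and>
     is_interp T2 (reduct (\<lambda>n. sum_encode (Inr n)) M) v"
proof -
  have all: "(\<forall>s. P s) \<longleftrightarrow> (\<forall>n. P (sum_encode (Inl n))) \<and> (\<forall>n. P (sum_encode (Inr n)))" for P
    by (metis sum_decode_inverse sum.exhaust)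
  have "is_structure (sig_union (sig T1) (sig T2)) M \<longleftrightarrow>
      is_structure (sig T1) (reduct (\<lambda>n. sum_encode (Inl n)) M) \<and>
      is_structure (sig T2) (reduct (\<lambda>n. sum_encode (Inr n)) M)"
    unfolding is_structure_def sig_union_def
    by (subst all) (auto simp: reduct_def)
  then show ?thesis
    unfolding is_interp_def disjoint_combination_def
    by (auto simp: sat_map_form ball_Un) (auto simp: reduct_def)
qed

lemma wf_trm_map_Inl:
  "wf_trm (sig_union \<Sigma>1 \<Sigma>2) (map_trm (\<lambda>n. sum_encode (Inl n)) t) = wf_trm \<Sigma>1 t"
  by (induction t) (auto simp: sig_union_def)

lemma wf_form_map_Inl:
  "wf_form (sig_union \<Sigma>1 \<Sigma>2) (map_form (\<lambda>n. sum_encode (Inl n)) \<phi>) = wf_form \<Sigma>1 \<phi>"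
  by (induction \<phi>) (auto simp: wf_trm_map_Inl, auto simp: sig_union_def)

lemma qfree_map_form: "qfree (map_form g \<phi>) = qfree \<phi>"
  by (induction \<phi>) auto

section \<open>Reduction of the undecidable set to the combination\<close>

text \<open>All \<open>T\<close>-models of \<open>\<phi>\<close> are finite, so for
  \<open>i \<in> K\<close> the axioms make the symbol \<open>i\<close> false in them. For
  \<open>i \<notin> K\<close>, such a model is expanded by making \<open>i\<close> the only true
  propositional symbol, and the axioms for \<open>K\<close> hold vacuously.\<close>

lemma satisfiable_forcing_combination:
  assumes sat: "satisfiable TYPE('u) T \<phi>" and fin: "\<not> inf_satisfiable TYPE('u) T \<phi>"
  shows "satisfiable TYPE('u) (disjoint_combination T (forcing_theory K))
      (Conj (map_form (\<lambda>n. sum_encode (Inl n)) \<phi>) (Rel (sum_encode (Inr i)) [])) \<longleftrightarrow> i \<notin> K"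
    (is "satisfiable _ ?T ?\<psi> \<longleftrightarrow> _")
proof
  assume "satisfiable TYPE('u) ?T ?\<psi>"
  then obtain M and v :: "nat \<Rightarrow> 'u" where M: "is_interp ?T M v" "sat M v ?\<psi>"
    unfolding satisfiable_def by blast
  have "is_interp T (reduct (\<lambda>n. sum_encode (Inl n)) M) v"
    "sat (reduct (\<lambda>n. sum_encode (Inl n)) M) v \<phi>"
    using M by (simp_all add: is_interp_disjoint_combination sat_map_form)
  with fin have "finite (Dom (reduct (\<lambda>n. sum_encode (Inl n)) M))"
    unfolding inf_satisfiable_def by blast
  then have "finite (Dom M)" by (simp add: reduct_def)
  with M show "i \<notin> K"
    by (auto simp: is_interp_disjoint_combination is_interp_forcing_theory reduct_def)
next
  assume i: "i \<notin> K"
  obtain N and v :: "nat \<Rightarrow> 'u" where N: "is_interp T N v" "sat N v \<phi>"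
    using sat unfolding satisfiable_def by blast
  define M where "M = \<lparr> Dom = Dom N,
    Fi = (\<lambda>s. case sum_decode s of Inl f \<Rightarrow> Fi N f | Inr f \<Rightarrow> undefined),
    Ri = (\<lambda>s. case sum_decode s of Inl p \<Rightarrow> Ri N p | Inr p \<Rightarrow> (\<lambda>_. p = i)) \<rparr>"
  have red: "reduct (\<lambda>n. sum_encode (Inl n)) M = N"
    by (simp add: reduct_def M_def)
  have "is_interp (forcing_theory K) (reduct (\<lambda>n. sum_encode (Inr n)) M) v"
    unfolding is_interp_forcing_theory using N(1) i
    by (auto simp: reduct_def M_def is_interp_def)
  then have "is_interp ?T M v" "sat M v ?\<psi>"
    using N red by (simp_all add: is_interp_disjoint_combination sat_map_form) (simp add: M_def)
  then show "satisfiable TYPE('u) ?T ?\<psi>" unfolding satisfiable_def by blast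
qed

text \<open>Otherwise the computable map from \<open>i\<close> to the code of the formula above,
  followed by the decision procedure, would decide the complement of \<open>K\<close>.\<close>

lemma stably_infinite_if_decidable_combination:
  assumes K: "\<not> recursive_pred 1 (\<lambda>xs. xs ! 0 \<notin> K)"
    and dec: "decidable TYPE('u) (disjoint_combination T (forcing_theory K))"
  shows "stably_infinite TYPE('u) T"
proof (rule ccontr)
  assume "\<not> stably_infinite TYPE('u) T"
  then obtain \<phi> where \<phi>: "wf_form (sig T) \<phi>" "qfree \<phi>" "satisfiable TYPE('u) T \<phi>"
      "\<not> inf_satisfiable TYPE('u) T \<phi>"
    unfolding stably_infinite_def by blast
  let ?T = "disjoint_combination T (forcing_theory K)"
  let ?\<phi> = "map_form (\<lambda>n. sum_encode (Inl n)) \<phi>"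
  define \<psi> where "\<psi> i = Conj ?\<phi> (Rel (sum_encode (Inr i)) [])" for i
  obtain r where r: "\<And>\<chi>. wf_form (sig ?T) \<chi> \<Longrightarrow> qfree \<chi> \<Longrightarrow>
      reval r [form_code \<chi>] (if satisfiable TYPE('u) ?T \<chi> then 1 else 0)"
    using dec unfolding decidable_def by blast
  have "wf_form (sig ?T) (\<psi> i)" "qfree (\<psi> i)" for i
    using \<phi>(1,2)
    by (simp_all add: \<psi>_def disjoint_combination_def wf_form_map_Inl qfree_map_form)
      (simp add: sig_union_def forcing_theory_def prop_sig_def)
  then have r_\<psi>: "reval r [form_code (\<psi> i)] (of_bool (i \<notin> K))" for i
    using r[of "\<psi> i"] satisfiable_forcing_combination[OF \<phi>(3,4), of K i]
    by (simp add: \<psi>_def of_bool_def)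
  \<comment> \<open>This is the code of \<open>\<psi> (xs ! 0)\<close>: 3 and 1 are the tags of
    \<open>Conj\<close> and \<open>Rel\<close>, \<open>Suc (2 * i)\<close> is
    \<open>sum_encode (Inr i)\<close>, 0 codes the empty list, and the code of
    \<open>?\<phi>\<close> is a constant.\<close>
  have "recursive 1 (\<lambda>xs. prod_encode (3, prod_encode (form_code ?\<phi>,
      prod_encode (1, prod_encode (Suc (2 * xs ! 0), 0)))))"
    by (intro recursive_intros recursive_proj) simp
  then have "recursive 1 (\<lambda>xs. form_code (\<psi> (xs ! 0)))"
    by (simp add: \<psi>_def sum_encode_def)
  then obtain s where s: "\<And>xs. length xs = 1 \<Longrightarrow> reval s xs (form_code (\<psi> (xs ! 0)))"
    unfolding recursive_def by blast
  have "reval (Comp r [s]) xs (of_bool (xs ! 0 \<notin> K))" if "length xs = 1" for xs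
    by (rule reval.comp[where ys = "[form_code (\<psi> (xs ! 0))]"]) (use s that r_\<psi> in simp_all)
  with K show False unfolding recursive_def by blast
qed

theorem theorem4p8:
  shows "\<exists>T'. is_theory T' \<and>
           decidable TYPE('u :: infinite) T' \<and> stably_infinite TYPE('u) T' \<and>
           (\<forall>T. is_theory T \<and> decidable TYPE('u) T \<and>
                decidable TYPE('u) (disjoint_combination T T') \<longrightarrow>
                stably_infinite TYPE('u) T)"
  \<comment> \<open>The witness is \<open>forcing_theory diagonal_set\<close>.\<close>
  using is_theory_forcing_theory decidable_forcing_theory stably_infinite_forcing_theory
    stably_infinite_if_decidable_combination[OF diagonal_set_undecidable]
  by blast

end
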